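(* Let $X$ and $Y$ be topological spaces and let $\phi:X\to Y$ be a continuous surjection. Let $\mathscr{H}$ be an ideal in $Y$. If $X$ is connected modulo $\phi^{-1}(\mathscr{H})$, then $Y$ is connected modulo $\mathscr{H}$.
   Context: An ideal in a set $X$ is a non-empty collection of subsets of $X$ closed under taking subsets and under binary unions (it need not be proper). For an ideal $\mathscr{H}$ in a space $X$, a mapping $f:X\to[0,1]$ is $2$-valued modulo $\mathscr{H}$ if $f^{-1}(0)\notin\mathscr{H}$, $f^{-1}(1)\notin\mathscr{H}$ and $X\setminus(f^{-1}(0)\cup f^{-1}(1))\in\mathscr{H}$. The space $X$ is connected modulo $\mathscr{H}$ if there is no continuous $f:X\to[0,1]$ which is $2$-valued modulo $\mathscr{H}$. For a mapping $\phi:X\to Y$ and an ideal $\mathscr{H}$ in $Y$, $\phi^{-1}(\mathscr{H})=\{A\subseteq X:\phi(A)\in\mathscr{H}\}$, which is an ideal in $X$. *)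

theory Defs
  imports "HOL-Analysis.Analysis"
begin

text \<open>Ideals need not be proper: \<^term>\<open>Pow X\<close> is an ideal in \<^term>\<open>X\<close>.\<close>

definition ideal_in :: "'a set \<Rightarrow> 'a set set \<Rightarrow> bool" where
  "ideal_in X H \<longleftrightarrow>
     H \<subseteq> Pow X \<and> H \<noteq> {} \<and>
     (\<forall>A\<in>H. \<forall>B. B \<subseteq> A \<longrightarrow> B \<in> H) \<and>
     (\<forall>A\<in>H. \<forall>B\<in>H. A \<union> B \<in> H)"

text \<open>Spaces are abstract topologies, so functions are total on the underlying type and
  all preimages are taken within the carrier.\<close>

definition two_valued_modulo :: "'a set \<Rightarrow> 'a set set \<Rightarrow> ('a \<Rightarrow> real) \<Rightarrow> bool" where
  "two_valued_modulo X H f \<longleftrightarrow>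
     {x \<in> X. f x = 0} \<notin> H \<and>
     {x \<in> X. f x = 1} \<notin> H \<and>
     X - ({x \<in> X. f x = 0} \<union> {x \<in> X. f x = 1}) \<in> H"

definition connected_modulo :: "'a topology \<Rightarrow> 'a set set \<Rightarrow> bool" where
  "connected_modulo X H \<longleftrightarrow>
     (\<nexists>f. continuous_map X (top_of_set {0..1::real}) f \<and> two_valued_modulo (topspace X) H f)"

definition preimage_ideal :: "'a set \<Rightarrow> ('a \<Rightarrow> 'b) \<Rightarrow> 'b set set \<Rightarrow> 'a set set" where
  "preimage_ideal X \<phi> H = {A. A \<subseteq> X \<and> \<phi> ` A \<in> H}"

lemma ideal_in_preimage_ideal:
  assumes "ideal_in Y H"
  shows "ideal_in X (preimage_ideal X \<phi> H)"
proof -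
  have nonempty: "H \<noteq> {}"
    and down: "\<And>A B. A \<in> H \<Longrightarrow> B \<subseteq> A \<Longrightarrow> B \<in> H"
    and union: "\<And>A B. A \<in> H \<Longrightarrow> B \<in> H \<Longrightarrow> A \<union> B \<in> H"
    using assms unfolding ideal_in_def by blast+
  have "{} \<in> H"
    using nonempty down by blast
  then have "{} \<in> preimage_ideal X \<phi> H"
    by (simp add: preimage_ideal_def)
  moreover have "B \<in> preimage_ideal X \<phi> H"
    if "A \<in> preimage_ideal X \<phi> H" "B \<subseteq> A" for A B
  proof -
    have "B \<subseteq> X" "\<phi> ` A \<in> H" "\<phi> ` B \<subseteq> \<phi> ` A"
      using that by (auto simp: preimage_ideal_def)
    with down[of "\<phi> ` A" "\<phi> ` B"] show ?thesis
      by (simp add: preimage_ideal_def)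
  qed
  moreover have "A \<union> B \<in> preimage_ideal X \<phi> H"
    if "A \<in> preimage_ideal X \<phi> H" "B \<in> preimage_ideal X \<phi> H" for A B
    using that union[of "\<phi> ` A" "\<phi> ` B"] by (simp add: preimage_ideal_def image_Un)
  moreover have "preimage_ideal X \<phi> H \<subseteq> Pow X"
    unfolding preimage_ideal_def by blast
  ultimately show ?thesis
    unfolding ideal_in_def by blast
qed

end

theory Submission
  imports Defs
begin

text \<open>By contraposition: a continuous \<open>f\<close> that is 2-valued modulo
  \<open>H\<close> on \<open>Y\<close> pulls back to \<open>f \<circ> \<phi>\<close>, continuous on
  \<open>X\<close>. Since \<open>\<phi>\<close> is onto, it maps the preimage of any B \<subseteq>
  \<open>Y\<close> exactly onto B, so that preimage lies in the pulled-back ideal iff B lies in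
  \<open>H\<close>; hence \<open>two_valued_modulo_comp\<close>.\<close>

lemma two_valued_modulo_comp:
  assumes surj: "\<phi> ` X = Y" and f: "two_valued_modulo Y H f"
  shows "two_valued_modulo X (preimage_ideal X \<phi> H) (f \<circ> \<phi>)"
proof -
  \<comment> \<open>Surjectivity gives equality, not mere inclusion: a smaller image could fall into
    \<open>H\<close> although the level set of \<open>f\<close> does not.\<close>
  have level: "\<phi> ` {x \<in> X. (f \<circ> \<phi>) x = c} = {y \<in> Y. f y = c}" for c
    using surj by auto
  have rest: "\<phi> ` (X - ({x \<in> X. (f \<circ> \<phi>) x = 0} \<union> {x \<in> X. (f \<circ> \<phi>) x = 1})) =
      Y - ({y \<in> Y. f y = 0} \<union> {y \<in> Y. f y = 1})"
    using surj by auto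
  show ?thesis
    using f unfolding two_valued_modulo_def preimage_ideal_def mem_Collect_eq level rest by blast
qed

theorem theorem2p9:
  fixes X :: "'a topology" and Y :: "'b topology"
    and \<phi> :: "'a \<Rightarrow> 'b" and H :: "'b set set"
  assumes "continuous_map X Y \<phi>"
    and "\<phi> ` topspace X = topspace Y"
    and "ideal_in (topspace Y) H"
    and "connected_modulo X (preimage_ideal (topspace X) \<phi> H)"
  shows "connected_modulo Y H"
  using assms(4) continuous_map_compose[OF assms(1)] two_valued_modulo_comp[OF assms(2)]
  unfolding connected_modulo_def by blast

end
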